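(* Let $X$ be a compact metrizable space equipped with a free continuous action of a compact group $G$. Then $$\dim\big((X*G)/G\big)\le\max\big(\dim(X/G),\ \dim(X)+1\big),$$ where $X*G$ carries the diagonal $G$-action.
   Context: Topological groups are Hausdorff. $\dim$ denotes covering dimension (equal to the inductive dimensions for separable metrizable spaces), which may take the value $\infty$. For compact spaces $X,Y$, the topological join $X*Y$ is the quotient of $X\times Y\times[0,1]$ by the relation which, for each fixed $y_0\in Y$, identifies all points $(x,y_0,0)$ ($x\in X$), and, for each fixed $x_0\in X$, identifies all points $(x_0,y,1)$ ($y\in Y$). The diagonal action on $X*G$ is $[(x,h,t)]\cdot g=[(xg,hg,t)]$. *)

theory Defs
  imports "HOL-Analysis.Analysis" "HOL-Algebra.Group"
begin

text \<open>
  Covering dimension in the sense of Lebesgue, with values in \<open>{-1, 0, 1, \<dots>, \<infinity>}\<close>. A cover has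
  order at most \<open>n\<close> if no point lies in more than \<open>n + 1\<close> of its members; thus \<open>-1\<close> is
  attained exactly by the empty space.
\<close>

definition covering_dim_le :: "'a topology \<Rightarrow> int \<Rightarrow> bool" where
  "covering_dim_le X n \<longleftrightarrow> -1 \<le> n \<and>
     (\<forall>\<U>. finite \<U> \<and> (\<forall>U\<in>\<U>. openin X U) \<and> \<Union>\<U> = topspace X \<longrightarrow>
        (\<exists>\<V>. finite \<V> \<and> (\<forall>V\<in>\<V>. openin X V) \<and> \<Union>\<V> = topspace X \<and>
             (\<forall>V\<in>\<V>. \<exists>U\<in>\<U>. V \<subseteq> U) \<and>
             (\<forall>x\<in>topspace X. int (card {V\<in>\<V>. x \<in> V}) \<le> n + 1)))"

definition covering_dim :: "'a topology \<Rightarrow> ereal" where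
  "covering_dim X = Inf {ereal (real_of_int n) | n. covering_dim_le X n}"


text \<open>
  The quotient of a space by an equivalence relation on its point set; points of the quotient
  are the equivalence classes.
\<close>

definition quotient_topology :: "'a topology \<Rightarrow> ('a \<times> 'a) set \<Rightarrow> 'a set topology" where
  "quotient_topology X R =
     topology (\<lambda>\<U>. \<U> \<subseteq> topspace X // R \<and> openin X {x \<in> topspace X. R `` {x} \<in> \<U>})"

lemma openin_quotient_topology:
  "openin (quotient_topology X R) \<U> \<longleftrightarrow>
     \<U> \<subseteq> topspace X // R \<and> openin X {x \<in> topspace X. R `` {x} \<in> \<U>}"
proof -
  have "istopology (\<lambda>\<U>. \<U> \<subseteq> topspace X // R \<and> openin X {x \<in> topspace X. R `` {x} \<in> \<U>})"
    unfolding istopology_def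
  proof (intro conjI allI impI)
    fix \<U> \<V>
    assume \<U>: "\<U> \<subseteq> topspace X // R \<and> openin X {x \<in> topspace X. R `` {x} \<in> \<U>}"
      and \<V>: "\<V> \<subseteq> topspace X // R \<and> openin X {x \<in> topspace X. R `` {x} \<in> \<V>}"
    show "\<U> \<inter> \<V> \<subseteq> topspace X // R"
      using \<U> by blast
    have "{x \<in> topspace X. R `` {x} \<in> \<U> \<inter> \<V>}
        = {x \<in> topspace X. R `` {x} \<in> \<U>} \<inter> {x \<in> topspace X. R `` {x} \<in> \<V>}"
      by blast
    then show "openin X {x \<in> topspace X. R `` {x} \<in> \<U> \<inter> \<V>}"
      using \<U> \<V> by (metis (no_types, lifting) openin_Int)
  next
    fix \<K>
    assume \<K>: "\<forall>\<U>\<in>\<K>. \<U> \<subseteq> topspace X // R \<and> openin X {x \<in> topspace X. R `` {x} \<in> \<U>}"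
    show "\<Union>\<K> \<subseteq> topspace X // R"
      using \<K> by blast
    have "{x \<in> topspace X. R `` {x} \<in> \<Union>\<K>} = \<Union>((\<lambda>\<U>. {x \<in> topspace X. R `` {x} \<in> \<U>}) ` \<K>)"
      by blast
    moreover have "openin X \<dots>"
      using \<K> by (intro openin_Union) blast
    ultimately show "openin X {x \<in> topspace X. R `` {x} \<in> \<Union>\<K>}"
      by simp
  qed
  then show ?thesis
    by (simp add: quotient_topology_def)
qed

lemma topspace_quotient_topology: "topspace (quotient_topology X R) = topspace X // R"
proof
  show "topspace (quotient_topology X R) \<subseteq> topspace X // R"
    by (metis openin_quotient_topology openin_topspace)
  have "{x \<in> topspace X. R `` {x} \<in> topspace X // R} = topspace X"
    by (auto intro: quotientI)
  then have "openin (quotient_topology X R) (topspace X // R)"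
    by (simp add: openin_quotient_topology)
  then show "topspace X // R \<subseteq> topspace (quotient_topology X R)"
    by (rule openin_subset)
qed

lemma quotient_map_quotient_topology:
  "quotient_map X (quotient_topology X R) (\<lambda>x. R `` {x})"
  unfolding quotient_map_def
  by (auto simp: topspace_quotient_topology openin_quotient_topology quotient_def)


definition join_rel :: "'a topology \<Rightarrow> 'b topology \<Rightarrow> (('a \<times> 'b \<times> real) \<times> ('a \<times> 'b \<times> real)) set" where
  "join_rel X Y =
     {((x, y, t), (x', y', t')) | x y t x' y' t'.
        x \<in> topspace X \<and> x' \<in> topspace X \<and> y \<in> topspace Y \<and> y' \<in> topspace Y \<and>
        t \<in> {0..1} \<and> t' \<in> {0..1} \<and>
        ((x, y, t) = (x', y', t') \<or> t = 0 \<and> t' = 0 \<and> y = y' \<or> t = 1 \<and> t' = 1 \<and> x = x')}"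

lemma equiv_join_rel: "equiv (topspace X \<times> topspace Y \<times> {0..1}) (join_rel X Y)"
  by (intro equivI refl_onI symI transI) (auto simp: join_rel_def)

definition join_topology :: "'a topology \<Rightarrow> 'b topology \<Rightarrow> ('a \<times> 'b \<times> real) set topology" where
  "join_topology X Y =
     quotient_topology (prod_topology X (prod_topology Y (top_of_set {0..1}))) (join_rel X Y)"


locale topological_group = group G
  for G :: "('g, 'm) monoid_scheme" (structure) and T :: "'g topology" +
  assumes topspace_eq_carrier: "topspace T = carrier G"
    and Hausdorff: "Hausdorff_space T"
    and continuous_mult: "continuous_map (prod_topology T T) T (\<lambda>(g, h). g \<otimes> h)"
    and continuous_inv: "continuous_map T T (\<lambda>g. inv g)"

locale continuous_right_action = topological_group G T
  for G :: "('g, 'm) monoid_scheme" (structure) and T :: "'g topology"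
    and X :: "'x topology" and act :: "'x \<Rightarrow> 'g \<Rightarrow> 'x" +
  assumes act_one: "x \<in> topspace X \<Longrightarrow> act x \<one> = x"
    and act_mult: "\<lbrakk>x \<in> topspace X; g \<in> carrier G; h \<in> carrier G\<rbrakk> \<Longrightarrow>
          act x (g \<otimes> h) = act (act x g) h"
    and continuous_act: "continuous_map (prod_topology X T) X (\<lambda>(x, g). act x g)"

definition free_action ::
  "('g, 'm) monoid_scheme \<Rightarrow> 'x topology \<Rightarrow> ('x \<Rightarrow> 'g \<Rightarrow> 'x) \<Rightarrow> bool" where
  "free_action G X act \<longleftrightarrow>
     (\<forall>x\<in>topspace X. \<forall>g\<in>carrier G. act x g = x \<longrightarrow> g = \<one>\<^bsub>G\<^esub>)"

definition orbit_rel ::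
  "('g, 'm) monoid_scheme \<Rightarrow> 'x topology \<Rightarrow> ('x \<Rightarrow> 'g \<Rightarrow> 'x) \<Rightarrow> ('x \<times> 'x) set" where
  "orbit_rel G X act = {(x, act x g) | x g. x \<in> topspace X \<and> g \<in> carrier G}"

definition orbit_space ::
  "('g, 'm) monoid_scheme \<Rightarrow> 'x topology \<Rightarrow> ('x \<Rightarrow> 'g \<Rightarrow> 'x) \<Rightarrow> 'x set topology" where
  "orbit_space G X act = quotient_topology X (orbit_rel G X act)"

text \<open>
  The diagonal action on the join with \<open>G\<close>: a point of the join is an equivalence class, and
  \<open>g\<close> acts by taking the image of the class. This is again a class, namely the one
  given by the usual formula on representatives, as shown below.
\<close>

definition join_act ::
  "('g, 'm) monoid_scheme \<Rightarrow> ('x \<Rightarrow> 'g \<Rightarrow> 'x) \<Rightarrow> ('x \<times> 'g \<times> real) set \<Rightarrow> 'g \<Rightarrow> ('x \<times> 'g \<times> real) set"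
  where
  "join_act G act C g = (\<lambda>(x, h, t). (act x g, h \<otimes>\<^bsub>G\<^esub> g, t)) ` C"

context continuous_right_action
begin

lemma act_closed:
  assumes "x \<in> topspace X" "g \<in> carrier G"
  shows "act x g \<in> topspace X"
  using continuous_map_funspace[OF continuous_act] assms
  by (auto simp: topspace_eq_carrier Pi_iff)

lemma act_inv_cancel:
  assumes "x \<in> topspace X" "g \<in> carrier G"
  shows "act (act x g) (inv g) = x" "act (act x (inv g)) g = x"
  using assms act_mult[of x g "inv g"] act_mult[of x "inv g" g] act_one by simp_all

lemma equiv_orbit_rel: "equiv (topspace X) (orbit_rel G X act)"
proof (rule equivI)
  show "orbit_rel G X act \<subseteq> topspace X \<times> topspace X"
    by (auto simp: orbit_rel_def act_closed)
  show "refl_on (topspace X) (orbit_rel G X act)"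
    by (rule refl_onI) (use act_one in \<open>force simp: orbit_rel_def\<close>)
  show "sym (orbit_rel G X act)"
  proof (rule symI)
    fix x y assume "(x, y) \<in> orbit_rel G X act"
    then obtain g where g: "x \<in> topspace X" "g \<in> carrier G" "y = act x g"
      by (auto simp: orbit_rel_def)
    then have "x = act y (inv g)" "y \<in> topspace X"
      by (simp_all add: act_inv_cancel act_closed)
    with g show "(y, x) \<in> orbit_rel G X act"
      unfolding orbit_rel_def by blast
  qed
  show "trans (orbit_rel G X act)"
  proof (rule transI)
    fix x y z assume "(x, y) \<in> orbit_rel G X act" "(y, z) \<in> orbit_rel G X act"
    then obtain g h where "x \<in> topspace X" "g \<in> carrier G" "h \<in> carrier G" "z = act x (g \<otimes> h)"
      by (auto simp: orbit_rel_def act_mult)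
    then show "(x, z) \<in> orbit_rel G X act"
      unfolding orbit_rel_def by blast
  qed
qed

lemma join_act_class:
  assumes x: "x \<in> topspace X" and h: "h \<in> carrier G" and t: "t \<in> {0..1}" and g: "g \<in> carrier G"
  shows "join_act G act (join_rel X T `` {(x, h, t)}) g = join_rel X T `` {(act x g, h \<otimes> g, t)}"
proof (intro subset_antisym subsetI)
  fix p assume "p \<in> join_act G act (join_rel X T `` {(x, h, t)}) g"
  then show "p \<in> join_rel X T `` {(act x g, h \<otimes> g, t)}"
    using g by (auto simp: join_act_def join_rel_def act_closed topspace_eq_carrier)
next
  fix p assume p: "p \<in> join_rel X T `` {(act x g, h \<otimes> g, t)}"
  obtain x' h' t' where p_eq: "p = (x', h', t')"
    by (cases p) auto
  have x': "x' \<in> topspace X" and h': "h' \<in> carrier G"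
    using p by (auto simp: p_eq join_rel_def topspace_eq_carrier)
  have h'_eq: "h' \<otimes> inv g \<otimes> g = h'"
    using h' g by (simp add: m_assoc)
  have h_eq: "h \<otimes> g \<otimes> inv g = h"
    using h g by (simp add: m_assoc)
  have "(act x' (inv g), h' \<otimes> inv g, t') \<in> join_rel X T `` {(x, h, t)}"
    using p x h g x' h' h_eq
    by (auto simp: p_eq join_rel_def act_closed topspace_eq_carrier act_inv_cancel)
  then show "p \<in> join_act G act (join_rel X T `` {(x, h, t)}) g"
    unfolding join_act_def p_eq
    by (rule rev_image_eqI) (simp add: act_inv_cancel x' g h'_eq)
qed

end

end

theory Submission
  imports Defs
begin

text \<open>
  Since \<open>(x, h, t)\<close> lies in the orbit of \<open>(x h\<^sup>-\<^sup>1, 1, t)\<close>, the space \<open>Z = (X * G)/G\<close> is the quotient of the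
  cylinder \<open>X \<times> [0, 1]\<close> that collapses \<open>X \<times> {0}\<close> to a point and \<open>X \<times> {1}\<close> to \<open>X/G\<close>. The quotient
  map is closed, so \<open>Z\<close> is normal, and it is injective on \<open>X \<times> (0, 1)\<close>. A finite open cover of \<open>Z\<close> is first
  refined so that its order is small on the copy of \<open>X/G\<close> and at the cone point; after passing to a closed
  shrinking, the points of large order form a closed set missing both, which lifts homeomorphically
  to the cylinder. There \<open>dim (X \<times> [0, 1]) \<le> dim X + 1\<close> permits a last refinement.

  For the cylinder, a cover of \<open>X\<close> of order \<open>n\<close> with a subordinate partition of unity cuts \<open>[0, 1]\<close>,
  depending on \<open>x\<close>, into at most \<open>n + 1\<close> intervals. Their integer translates tile the line, and a unit window
  moving with \<open>t\<close> meets at most \<open>n + 2\<close> tiles; the sets of those \<open>(x, t)\<close> whose window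
  meets a given tile form the required cover.
\<close>

section \<open>Covering dimension\<close>

lemma covering_dim_le_mono:
  assumes "covering_dim_le X m" "m \<le> n"
  shows "covering_dim_le X n"
  unfolding covering_dim_le_def
proof (intro conjI allI impI)
  show "-1 \<le> n" using assms by (simp add: covering_dim_le_def)
  fix \<U> assume "finite \<U> \<and> (\<forall>U\<in>\<U>. openin X U) \<and> \<Union>\<U> = topspace X"
  from assms(1)[unfolded covering_dim_le_def, THEN conjunct2, THEN spec, THEN mp, OF this]
  show "\<exists>\<V>. finite \<V> \<and> (\<forall>V\<in>\<V>. openin X V) \<and> \<Union>\<V> = topspace X \<and>
     (\<forall>V\<in>\<V>. \<exists>U\<in>\<U>. V \<subseteq> U) \<and> (\<forall>x\<in>topspace X. int (card {V\<in>\<V>. x \<in> V}) \<le> n + 1)"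
    by (rule ex_forward) (use assms(2) in fastforce)
qed

lemma covering_dim_le_imp_le: "covering_dim_le X n \<Longrightarrow> covering_dim X \<le> ereal (real_of_int n)"
  unfolding covering_dim_def by (rule Inf_lower) blast

text \<open>The admissible bounds are integers from -1 on, so their infimum is a minimum as soon as
  one exists; if none exists, the infimum is \<infinity>.\<close>

lemma covering_dim_attained:
  assumes "covering_dim X \<noteq> \<infinity>"
  obtains n where "covering_dim_le X n" "covering_dim X = ereal (real_of_int n)"
proof -
  have "\<exists>n. covering_dim_le X n"
  proof (rule ccontr)
    assume "\<nexists>n. covering_dim_le X n"
    then have "{ereal (real_of_int n) | n. covering_dim_le X n} = {}" by simp
    then show False
      using assms unfolding covering_dim_def by (metis Inf_empty top_ereal_def)
  qed
  then obtain n where n: "covering_dim_le X n" ..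
  then have "covering_dim_le X (int (nat (n + 1)) - 1)"
    by (simp add: covering_dim_le_def)
  \<comment> \<open>The shift by one turns bounds starting at -1 into natural numbers, to which
    \<open>LEAST\<close> applies.\<close>
  define k where "k = (LEAST k. covering_dim_le X (int k - 1))"
  have k: "covering_dim_le X (int k - 1)"
    unfolding k_def by (rule LeastI) fact
  have "int k - 1 \<le> m" if "covering_dim_le X m" for m
  proof -
    have "covering_dim_le X (int (nat (m + 1)) - 1)" and "-1 \<le> m"
      using that by (auto simp: covering_dim_le_def)
    then have "k \<le> nat (m + 1)"
      unfolding k_def by (intro Least_le)
    with \<open>-1 \<le> m\<close> show ?thesis by linarith
  qed
  then have "ereal (real_of_int (int k - 1)) \<le> covering_dim X"
    unfolding covering_dim_def by (intro Inf_greatest) (auto simp del: of_int_diff)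
  with k show thesis
    using that covering_dim_le_imp_le by (meson antisym)
qed

text \<open>Passing from an indexed family to its range can only merge members, so counting indices
  bounds the order. The free index type allows convenient labels, such as pairs of naturals.\<close>

lemma covering_dim_leI:
  assumes "-1 \<le> n"
    and "\<And>\<U>. \<lbrakk>finite \<U>; \<And>U. U \<in> \<U> \<Longrightarrow> openin X U; \<Union>\<U> = topspace X\<rbrakk> \<Longrightarrow>
      \<exists>(I::'i set) V. finite I \<and> (\<forall>i\<in>I. openin X (V i)) \<and> \<Union>(V ` I) = topspace X \<and>
        (\<forall>i\<in>I. \<exists>U\<in>\<U>. V i \<subseteq> U) \<and> (\<forall>x\<in>topspace X. int (card {i\<in>I. x \<in> V i}) \<le> n + 1)"
  shows "covering_dim_le X n"
  unfolding covering_dim_le_def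
proof (intro conjI allI impI)
  fix \<U> assume \<U>: "finite \<U> \<and> (\<forall>U\<in>\<U>. openin X U) \<and> \<Union>\<U> = topspace X"
  obtain I :: "'i set" and V where V: "finite I" "\<forall>i\<in>I. openin X (V i)" "\<Union>(V ` I) = topspace X"
    "\<forall>i\<in>I. \<exists>U\<in>\<U>. V i \<subseteq> U" "\<forall>x\<in>topspace X. int (card {i\<in>I. x \<in> V i}) \<le> n + 1"
    using assms(2)[of \<U>] \<U> by (elim exE conjE) auto
  have "int (card {W\<in>V ` I. x \<in> W}) \<le> n + 1" if "x \<in> topspace X" for x
  proof -
    have "{W\<in>V ` I. x \<in> W} = V ` {i\<in>I. x \<in> V i}"
      by auto
    then have "card {W\<in>V ` I. x \<in> W} \<le> card {i\<in>I. x \<in> V i}"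
      using V(1) by (simp add: card_image_le)
    then show ?thesis
      using V(5) that by fastforce
  qed
  then show "\<exists>\<V>. finite \<V> \<and> (\<forall>V\<in>\<V>. openin X V) \<and> \<Union>\<V> = topspace X \<and>
             (\<forall>V\<in>\<V>. \<exists>U\<in>\<U>. V \<subseteq> U) \<and> (\<forall>x\<in>topspace X. int (card {V\<in>\<V>. x \<in> V}) \<le> n + 1)"
    using V by (intro exI[of _ "V ` I"]) auto
qed (fact assms(1))

text \<open>Each member of a refinement is assigned to one \<open>U i\<close> containing it, and
  \<open>V i\<close> is the union of those assigned to \<open>i\<close>. Distinct indices at a point
  come from distinct members, so the order does not grow. Keeping \<open>I\<close> lets successive
  refinements be compared index by index.\<close>

lemma covering_dim_le_indexed_refinement:
  assumes "covering_dim_le X n" "finite I" "\<And>i. i \<in> I \<Longrightarrow> openin X (U i)"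
    and "\<Union>(U ` I) = topspace X"
  obtains V where "\<forall>i\<in>I. openin X (V i)" "\<forall>i\<in>I. V i \<subseteq> U i"
    "\<Union>(V ` I) = topspace X" "\<forall>x\<in>topspace X. int (card {i\<in>I. x \<in> V i}) \<le> n + 1"
proof -
  have "finite (U ` I) \<and> (\<forall>W\<in>U ` I. openin X W) \<and> \<Union>(U ` I) = topspace X"
    using assms by auto
  from assms(1)[unfolded covering_dim_le_def, THEN conjunct2, THEN spec, THEN mp, OF this]
  obtain \<V> where \<V>: "finite \<V>" "\<forall>V\<in>\<V>. openin X V" "\<Union>\<V> = topspace X"
      "\<forall>V\<in>\<V>. \<exists>W\<in>U ` I. V \<subseteq> W" "\<forall>x\<in>topspace X. int (card {V\<in>\<V>. x \<in> V}) \<le> n + 1"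
    by (elim exE conjE)
  have "\<forall>V\<in>\<V>. \<exists>i\<in>I. V \<subseteq> U i"
    using \<V>(4) by blast
  then obtain c where c: "\<And>V. V \<in> \<V> \<Longrightarrow> c V \<in> I \<and> V \<subseteq> U (c V)"
    by metis
  define V where "V i = \<Union>{W\<in>\<V>. c W = i}" for i
  have "int (card {i\<in>I. x \<in> V i}) \<le> n + 1" if "x \<in> topspace X" for x
  proof -
    have "{i\<in>I. x \<in> V i} \<subseteq> c ` {W\<in>\<V>. x \<in> W}"
      by (auto simp: V_def)
    then have "card {i\<in>I. x \<in> V i} \<le> card {W\<in>\<V>. x \<in> W}"
      using \<V>(1) by (simp add: surj_card_le)
    then show ?thesis
      using \<V>(5) that by fastforce
  qed
  moreover have "\<Union>(V ` I) = topspace X"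
    using c unfolding V_def \<V>(3)[symmetric] by blast
  moreover have "\<forall>i\<in>I. openin X (V i)" "\<forall>i\<in>I. V i \<subseteq> U i"
    using \<V>(2) c by (auto simp: V_def)
  ultimately show thesis
    using that by blast
qed

section \<open>Shrinking in normal spaces and covers of closed images\<close>

text \<open>\<open>R\<close> is the part of the cover that is not being shrunk. The induction counts
  \<open>U a\<close> as part of it while the other sets are shrunk; what they and \<open>R\<close>
  then leave uncovered is a closed subset of \<open>U a\<close>, and normality supplies the new set
  for \<open>a\<close>.\<close>

lemma normal_space_shrink_cover_rel:
  assumes "normal_space X" "finite I" "\<And>i. i \<in> I \<Longrightarrow> openin X (U i)" "openin X R"
    and "topspace X \<subseteq> \<Union>(U ` I) \<union> R"
  shows "\<exists>V. (\<forall>i\<in>I. openin X (V i) \<and> X closure_of V i \<subseteq> U i) \<and> topspace X \<subseteq> \<Union>(V ` I) \<union> R"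
  using assms(2-)
proof (induction I arbitrary: R rule: finite_induct)
  case (insert a I)
  have "\<exists>V. (\<forall>i\<in>I. openin X (V i) \<and> X closure_of V i \<subseteq> U i) \<and> topspace X \<subseteq> \<Union>(V ` I) \<union> (U a \<union> R)"
    using insert.prems by (intro insert.IH) auto
  then obtain V where V: "\<forall>i\<in>I. openin X (V i) \<and> X closure_of V i \<subseteq> U i"
      "topspace X \<subseteq> \<Union>(V ` I) \<union> (U a \<union> R)"
    by blast
  have "closedin X (topspace X - (\<Union>(V ` I) \<union> R))"
    using V(1) insert.prems(2) by (intro closedin_diff openin_Un openin_Union) auto
  moreover have "topspace X - (\<Union>(V ` I) \<union> R) \<subseteq> U a"
    using V(2) by blast
  ultimately obtain W where W: "openin X W" "topspace X - (\<Union>(V ` I) \<union> R) \<subseteq> W" "X closure_of W \<subseteq> U a"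
    using assms(1) insert.prems(1) unfolding normal_space_alt by (metis insertI1)
  show ?case
    using V W insert.hyps by (intro exI[of _ "V(a := W)"]) auto
qed auto

lemma normal_space_shrink_cover:
  assumes "normal_space X" "finite I" "\<And>i. i \<in> I \<Longrightarrow> openin X (U i)" "\<Union>(U ` I) = topspace X"
  obtains V where "\<forall>i\<in>I. openin X (V i)" "\<forall>i\<in>I. X closure_of V i \<subseteq> U i"
    "\<Union>(V ` I) = topspace X"
proof -
  obtain V where V: "\<forall>i\<in>I. openin X (V i) \<and> X closure_of V i \<subseteq> U i" "topspace X \<subseteq> \<Union>(V ` I) \<union> {}"
    using normal_space_shrink_cover_rel[of X I U "{}"] assms by auto
  moreover have "\<Union>(V ` I) \<subseteq> topspace X"
    using V(1) by (meson UN_least openin_subset)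
  ultimately show thesis
    using that by blast
qed

text \<open>A refinement of the preimage cover is transported along \<open>F\<close> only.
  Closedness of \<open>f\<close> makes the removed sets closed, and injectivity on \<open>F\<close>
  keeps an image point in every \<open>V i\<close> whose \<open>W i\<close> contains its preimage in
  \<open>F\<close>.\<close>

lemma refine_cover_on_closed_image:
  assumes "covering_dim_le Y n" and f: "continuous_map Y Z f" "closed_map Y Z f"
    and F: "closedin Y F" "inj_on f F"
    and U: "finite I" "\<And>i. i \<in> I \<Longrightarrow> openin Z (U i)" "\<Union>(U ` I) = topspace Z"
  obtains V where "\<forall>i\<in>I. openin Z (V i)" "\<forall>i\<in>I. V i \<subseteq> U i"
    "\<Union>(V ` I) = topspace Z" "\<forall>y\<in>F. int (card {i\<in>I. f y \<in> V i}) \<le> n + 1"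
proof -
  define P where "P i = {y \<in> topspace Y. f y \<in> U i}" for i
  have P: "openin Y (P i)" if "i \<in> I" for i
    using that f(1) U(2) by (auto simp: P_def intro: openin_continuous_map_preimage)
  have P_cover: "\<Union>(P ` I) = topspace Y"
    using continuous_map_image_subset_topspace[OF f(1)] U(3) by (auto simp: P_def)
  obtain W where W: "\<forall>i\<in>I. openin Y (W i)" "\<forall>i\<in>I. W i \<subseteq> P i"
      "\<Union>(W ` I) = topspace Y" "\<forall>y\<in>topspace Y. int (card {i\<in>I. y \<in> W i}) \<le> n + 1"
    by (rule covering_dim_le_indexed_refinement[OF assms(1) U(1) P P_cover]) (assumption | rule that)+
  \<comment> \<open>Only points of \<open>f ` F\<close> are removed, so no point outside loses its cover.\<close>
  define V where "V i = U i - f ` (F - W i)" for i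
  have FY: "F \<subseteq> topspace Y"
    using F(1) closedin_subset by blast
  have V_open: "\<forall>i\<in>I. openin Z (V i)"
    using f(2) F(1) W(1) U(2) unfolding V_def closed_map_def by blast
  have V_sub: "\<forall>i\<in>I. V i \<subseteq> U i"
    by (auto simp: V_def)
  have V_cover: "topspace Z \<subseteq> \<Union>(V ` I)"
  proof
    fix z assume z: "z \<in> topspace Z"
    show "z \<in> \<Union>(V ` I)"
    proof (cases "z \<in> f ` F")
      case True
      then obtain y where y: "y \<in> F" "z = f y" by blast
      then obtain i where i: "i \<in> I" "y \<in> W i"
        using W(3) FY by blast
      then have "z \<in> V i"
        using bspec[OF W(2), of i] y F(2) by (auto simp: V_def P_def inj_on_def)
      then show ?thesis using i by blast
    next
      case False
      obtain i where "i \<in> I" "z \<in> U i"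
        using z U(3) by blast
      with False show ?thesis
        by (auto simp: V_def)
    qed
  qed
  have "int (card {i\<in>I. f y \<in> V i}) \<le> n + 1" if "y \<in> F" for y
  proof -
    have "{i\<in>I. f y \<in> V i} \<subseteq> {i\<in>I. y \<in> W i}"
      using that by (auto simp: V_def)
    then have "card {i\<in>I. f y \<in> V i} \<le> card {i\<in>I. y \<in> W i}"
      using U(1) by (simp add: card_mono)
    then show ?thesis
      using W(4) that FY by fastforce
  qed
  moreover have "\<Union>(V ` I) = topspace Z"
    using V_cover V_sub U(3) by blast
  ultimately show thesis
    using that[OF V_open V_sub] by blast
qed

text \<open>The set is a finite union, over the \<open>J\<close> with more than \<open>k\<close>
  indices, of the intersections of the \<open>C i\<close> with \<open>i\<close> in
  \<open>J\<close>.\<close>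

lemma closedin_card_gt:
  assumes "finite I" "\<And>i. i \<in> I \<Longrightarrow> closedin X (C i)"
  shows "closedin X {x \<in> topspace X. k < card {i\<in>I. x \<in> C i}}"
proof -
  have "{x \<in> topspace X. k < card {i\<in>I. x \<in> C i}} =
      \<Union>((\<lambda>J. topspace X \<inter> \<Inter>(C ` J)) ` {J. J \<subseteq> I \<and> k < card J})" (is "?l = ?r")
  proof
    show "?l \<subseteq> ?r"
    proof
      fix x assume "x \<in> ?l"
      then show "x \<in> ?r"
        by (intro UN_I[of "{i\<in>I. x \<in> C i}"]) auto
    qed
    show "?r \<subseteq> ?l"
    proof clarsimp
      fix x J assume "J \<subseteq> I" "k < card J" "\<forall>i\<in>J. x \<in> C i"
      moreover have "card J \<le> card {i\<in>I. x \<in> C i}"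
        using calculation assms(1) by (intro card_mono) auto
      ultimately show "k < card {i\<in>I. x \<in> C i}" by linarith
    qed
  qed
  moreover have "closedin X ?r"
  proof (intro closedin_Union)
    fix S assume "S \<in> (\<lambda>J. topspace X \<inter> \<Inter>(C ` J)) ` {J. J \<subseteq> I \<and> k < card J}"
    then obtain J where "J \<subseteq> I" "k < card J" "S = topspace X \<inter> \<Inter>(C ` J)" by blast
    \<comment> \<open>Such a \<open>J\<close> is nonempty because its cardinality exceeds
      \<open>k\<close>, so this is not the empty intersection.\<close>
    moreover have "closedin X (\<Inter>(C ` J))"
      using calculation assms(2) by (intro closedin_Inter) auto
    ultimately show "closedin X S" by auto
  qed (use assms(1) in auto)
  ultimately show ?thesis by simp
qed

text \<open>In the application \<open>p\<close> is the quotient map from the cylinder,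
  \<open>F\<close> a point over the cone point and \<open>q\<close> the embedding of the orbit space
  of \<open>X\<close>. Bounds obtained on the images of \<open>F\<close> and \<open>Y'\<close>
  survive later refinements because every family keeps the index set and shrinks memberwise.\<close>

lemma covering_dim_le_closed_image:
  fixes Z :: "'z topology"
  assumes Z: "normal_space Z"
    and Y: "covering_dim_le Y n" "continuous_map Y Z p" "closed_map Y Z p" "p ` topspace Y = topspace Z"
    and F: "closedin Y F" "inj_on p F"
    and Y': "covering_dim_le Y' n" "continuous_map Y' Z q" "closed_map Y' Z q" "inj_on q (topspace Y')"
    and inj: "inj_on p {y \<in> topspace Y. p y \<notin> p ` F \<union> q ` topspace Y'}"
  shows "covering_dim_le Z n"
proof (rule covering_dim_leI)
  show n: "-1 \<le> n" using Y(1) by (simp add: covering_dim_le_def)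
  fix \<U> assume fin: "finite \<U>" and op: "\<And>U. U \<in> \<U> \<Longrightarrow> openin Z U" and "\<Union>\<U> = topspace Z"
  \<comment> \<open>The cover \<open>\<U>\<close> indexes itself; all later families use it as index
    set.\<close>
  then have cov: "\<Union>((\<lambda>U. U) ` \<U>) = topspace Z" by simp
  obtain V1 where V1: "\<forall>i\<in>\<U>. openin Z (V1 i)" "\<forall>i\<in>\<U>. V1 i \<subseteq> i"
    "\<Union>(V1 ` \<U>) = topspace Z" "\<forall>y\<in>F. int (card {i\<in>\<U>. p y \<in> V1 i}) \<le> n + 1"
    by (rule refine_cover_on_closed_image[OF Y(1-3) F fin op cov]) (assumption | rule that)+
  obtain V2 where V2: "\<forall>i\<in>\<U>. openin Z (V2 i)" "\<forall>i\<in>\<U>. V2 i \<subseteq> V1 i"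
    "\<Union>(V2 ` \<U>) = topspace Z" "\<forall>y\<in>topspace Y'. int (card {i\<in>\<U>. q y \<in> V2 i}) \<le> n + 1"
    by (rule refine_cover_on_closed_image[OF Y'(1-3) closedin_topspace Y'(4) fin bspec[OF V1(1)] V1(3)]) (assumption | rule that)+
  obtain W where W: "\<forall>i\<in>\<U>. openin Z (W i)" "\<forall>i\<in>\<U>. Z closure_of W i \<subseteq> V2 i"
    "\<Union>(W ` \<U>) = topspace Z"
    by (rule normal_space_shrink_cover[OF Z fin bspec[OF V2(1)] V2(3)]) (assumption | rule that)+
  have W_sub: "W i \<subseteq> Z closure_of W i" if "i \<in> \<U>" for i
    using bspec[OF W(1) that] by (simp add: closure_of_subset openin_subset)
  \<comment> \<open>\<open>B\<close> is closed because the closures, not the \<open>W i\<close>, are counted, and it misses the two pieces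
    because these closures still lie in \<open>V1 i\<close> and \<open>V2 i\<close>.\<close>
  define B where "B = {z \<in> topspace Z. nat (n + 1) < card {i\<in>\<U>. z \<in> Z closure_of W i}}"
  have "closedin Z B"
    unfolding B_def using fin by (intro closedin_card_gt) auto
  then have FB: "closedin Y {y \<in> topspace Y. p y \<in> B}"
    using Y(2) by (rule closedin_continuous_map_preimage[rotated])
  have small: "z \<notin> B" if "int (card {i\<in>\<U>. z \<in> V i}) \<le> n + 1" "\<forall>i\<in>\<U>. Z closure_of W i \<subseteq> V i" for z V
  proof -
    have "card {i\<in>\<U>. z \<in> Z closure_of W i} \<le> card {i\<in>\<U>. z \<in> V i}"
      using fin that(2) by (intro card_mono) auto
    then show ?thesis
      using that(1) by (auto simp: B_def)
  qed
  have "z \<notin> B" if "z \<in> p ` F \<union> q ` topspace Y'" for z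
    using that small[of z V1] small[of z V2] V1(4) V2(2,4) W(2) by blast
  then have inj_B: "inj_on p {y \<in> topspace Y. p y \<in> B}"
    by (intro inj_on_subset[OF inj]) blast
  obtain V where V: "\<forall>i\<in>\<U>. openin Z (V i)" "\<forall>i\<in>\<U>. V i \<subseteq> W i"
    "\<Union>(V ` \<U>) = topspace Z" "\<forall>y\<in>{y \<in> topspace Y. p y \<in> B}. int (card {i\<in>\<U>. p y \<in> V i}) \<le> n + 1"
    by (rule refine_cover_on_closed_image[OF Y(1-3) FB inj_B fin bspec[OF W(1)] W(3)]) (assumption | rule that)+
  have "int (card {i\<in>\<U>. z \<in> V i}) \<le> n + 1" if z: "z \<in> topspace Z" for z
  proof (cases "z \<in> B")
    case True
    then show ?thesis
      using z V(4) Y(4) by force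
  next
    case False
    \<comment> \<open>Off \<open>B\<close> the closures already satisfy the bound, and each
      \<open>V i\<close> lies in \<open>W i\<close>.\<close>
    have "card {i\<in>\<U>. z \<in> V i} \<le> card {i\<in>\<U>. z \<in> Z closure_of W i}"
      using fin V(2) W_sub by (intro card_mono) auto
    also have "\<dots> \<le> nat (n + 1)"
      using False z by (simp add: B_def)
    finally show ?thesis using n by linarith
  qed
  moreover have "\<forall>i\<in>\<U>. \<exists>U\<in>\<U>. V i \<subseteq> U"
    using V(2) W_sub W(2) V2(2) V1(2) by (meson order_trans)
  ultimately show "\<exists>(I::'z set set) V. finite I \<and> (\<forall>i\<in>I. openin Z (V i)) \<and> \<Union>(V ` I) = topspace Z \<and>
        (\<forall>i\<in>I. \<exists>U\<in>\<U>. V i \<subseteq> U) \<and> (\<forall>x\<in>topspace Z. int (card {i\<in>I. x \<in> V i}) \<le> n + 1)"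
    using fin V(1,3) by (intro exI[of _ \<U>] exI[of _ V] conjI ballI) auto
qed

section \<open>Cylinders\<close>

lemma le_of_steps:
  fixes s :: "nat \<Rightarrow> real"
  assumes "\<And>i. i < r \<Longrightarrow> s i \<le> s (Suc i)" "i \<le> k" "k \<le> r"
  shows "s i \<le> s k"
  using assms(2,3)
proof (induction k rule: dec_induct)
  case (step k)
  then show ?case
    using assms(1)[of k] by simp
qed simp

text \<open>The pair \<open>(i, j)\<close> encodes the interval from \<open>s i\<close> to
  \<open>s (Suc i)\<close> translated by \<open>j\<close>; the window runs from \<open>y\<close> to
  \<open>y + 1\<close>. Degenerate intervals are left out so that the bound counts only indices
  whose partition function is positive.\<close>

lemma card_tiles_meeting_unit_window:
  fixes s :: "nat \<Rightarrow> real" and y :: real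
  assumes mono: "\<And>i. i < r \<Longrightarrow> s i \<le> s (Suc i)" and "s 0 = 0" "s r = 1"
  defines "T \<equiv> {(i, j::nat). i < r \<and> s i < s (Suc i) \<and> s i + real j < y + 1 \<and> y < s (Suc i) + real j}"
  shows "finite T" "card T \<le> card {i. i < r \<and> s i < s (Suc i)} + 1"
proof -
  have s_le: "s i \<le> s k" if "i \<le> k" "k \<le> r" for i k
    using le_of_steps[of r s] mono that by blast
  have s01: "0 \<le> s i" "s i \<le> 1" if "i \<le> r" for i
    using s_le[of 0 i] s_le[of i r] that assms by auto
  have "T \<subseteq> {..<r} \<times> {..nat \<lfloor>y + 1\<rfloor>}"
  proof
    fix p assume "p \<in> T"
    then obtain i j where p: "p = (i, j)" "i < r" "s i + real j < y + 1" by (auto simp: T_def)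
    then have "real j \<le> y + 1"
      using s01(1)[of i] by auto
    then have "j \<le> nat \<lfloor>y + 1\<rfloor>"
      by (rule le_nat_floor)
    then show "p \<in> {..<r} \<times> {..nat \<lfloor>y + 1\<rfloor>}"
      using p by simp
  qed
  then show "finite T"
    by (rule finite_subset) auto
  \<comment> \<open>At most one tile contains \<open>y\<close> in its interior; any other tile in \<open>T\<close> starts in \<open>[y, y + 1)\<close>,
    which determines its translate.\<close>
  define T0 where "T0 = {(i, j) \<in> T. s i + real j < y}"
  have "p = q" if pq: "p \<in> T0" "q \<in> T0" for p q
  proof -
    obtain i j i' j' where ij: "p = (i, j)" "q = (i', j')"
      by (cases p, cases q) auto
    \<comment> \<open>Since \<open>s\<close> takes values between 0 and 1, \<open>y\<close> lies
      strictly between \<open>j\<close> and \<open>j + 1\<close>, which fixes the translate;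
      monotonicity of \<open>s\<close> then fixes the index.\<close>
    then have *: "i < r" "i' < r" "s i + real j < y" "y < s (Suc i) + real j" "s i' + real j' < y" "y < s (Suc i') + real j'"
      using pq by (auto simp: T0_def T_def)
    then have "real j < y" "y < real j + 1" "real j' < y" "y < real j' + 1"
      using s01[of i] s01[of i'] s01[of "Suc i"] s01[of "Suc i'"] by auto
    then have "j = j'" by linarith
    moreover have "\<not> i < i'" "\<not> i' < i"
      using * s_le[of "Suc i" i'] s_le[of "Suc i'" i] \<open>j = j'\<close> by (auto simp: Suc_le_eq)
    ultimately show ?thesis using ij by auto
  qed
  moreover have "T0 \<subseteq> T" by (auto simp: T0_def)
  ultimately have "card T0 \<le> 1"
    by (metis One_nat_def card_le_Suc0_iff_eq finite_subset \<open>finite T\<close>)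
  have "inj_on fst (T - T0)"
    by (rule inj_onI) (auto simp: T_def T0_def)
  then have "card (T - T0) = card (fst ` (T - T0))"
    by (simp add: card_image)
  also have "\<dots> \<le> card {i. i < r \<and> s i < s (Suc i)}"
    by (rule card_mono) (auto simp: T_def)
  finally show "card T \<le> card {i. i < r \<and> s i < s (Suc i)} + 1"
    using \<open>card T0 \<le> 1\<close> card_Diff_subset[OF finite_subset[OF \<open>T0 \<subseteq> T\<close> \<open>finite T\<close>] \<open>T0 \<subseteq> T\<close>]
    by linarith
qed

text \<open>The translate is the integer part of \<open>y\<close>, and the interval is the one
  ending at the first \<open>s k\<close> above the fractional part. The strict inequality on the
  right makes the tile nondegenerate.\<close>

lemma tile_containing_point:
  fixes s :: "nat \<Rightarrow> real"
  assumes "s 0 = 0" "s r = 1" "0 \<le> y"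
  obtains i where "i < r" "s i + real (nat \<lfloor>y\<rfloor>) \<le> y" "y < s (Suc i) + real (nat \<lfloor>y\<rfloor>)"
proof -
  define z where "z = y - real (nat \<lfloor>y\<rfloor>)"
  have z: "0 \<le> z" "z < 1"
    using assms(3) unfolding z_def by linarith+
  define k where "k = (LEAST k. z < s k)"
  have "z < s r" using z assms(2) by simp
  then have k: "z < s k" "k \<le> r"
    unfolding k_def by (rule LeastI, rule Least_le)
  \<comment> \<open>Index 0 is excluded by \<open>s 0 = 0\<close>, so \<open>k\<close> has a
    predecessor, at which the inequality fails by minimality.\<close>
  have "k \<noteq> 0" using k(1) z(1) assms(1) by (metis not_less)
  then obtain i where i: "k = Suc i" by (cases k) auto
  then have "\<not> z < s i"
    unfolding k_def by (metis lessI not_less_Least)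
  then show thesis
    using that[of i] k i by (auto simp: z_def)
qed

text \<open>\<open>s x i\<close> is the sum of the first \<open>i\<close> functions of a partition
  of unity, so the functions appear as lengths of consecutive intervals. They are Urysohn functions,
  1 on the closure of a shrunken \<open>W i\<close> and 0 off \<open>V i\<close>, divided by their
  sum.\<close>

lemma partition_of_unit_interval_subordinate:
  assumes "normal_space X" and V: "\<And>i. i < r \<Longrightarrow> openin X (V i)" "(\<Union>i<r. V i) = topspace X"
  obtains s :: "'a \<Rightarrow> nat \<Rightarrow> real" where
    "\<And>i. i \<le> r \<Longrightarrow> continuous_map X euclideanreal (\<lambda>x. s x i)"
    "\<And>x. s x 0 = 0" "\<And>x. x \<in> topspace X \<Longrightarrow> s x r = 1"
    "\<And>x i. x \<in> topspace X \<Longrightarrow> i < r \<Longrightarrow> s x i \<le> s x (Suc i)"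
    "\<And>x i. x \<in> topspace X \<Longrightarrow> i < r \<Longrightarrow> s x i < s x (Suc i) \<Longrightarrow> x \<in> V i"
proof -
  obtain W where W: "\<forall>i\<in>{..<r}. openin X (W i)" "\<forall>i\<in>{..<r}. X closure_of W i \<subseteq> V i" "\<Union>(W ` {..<r}) = topspace X"
    using V by (auto intro: normal_space_shrink_cover[OF assms(1), of "{..<r}" V])
  have "\<exists>f. continuous_map X (top_of_set {0..1::real}) f \<and> f ` (topspace X - V i) \<subseteq> {0} \<and> f ` (X closure_of W i) \<subseteq> {1}"
    if "i < r" for i
  proof -
    have "closedin X (topspace X - V i)" "closedin X (X closure_of W i)" "disjnt (topspace X - V i) (X closure_of W i)"
      using V(1) W(2) that by (auto simp: disjnt_def)
    then show ?thesis
      using assms(1) unfolding normal_space_iff_Urysohn by blast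
  qed
  then obtain f where f: "\<And>i. i < r \<Longrightarrow> continuous_map X (top_of_set {0..1::real}) (f i)"
    "\<And>i. i < r \<Longrightarrow> f i ` (topspace X - V i) \<subseteq> {0}" "\<And>i. i < r \<Longrightarrow> f i ` (X closure_of W i) \<subseteq> {1}"
    by metis
  have f_cont: "continuous_map X euclideanreal (f i)" and f_nonneg: "\<And>x. x \<in> topspace X \<Longrightarrow> 0 \<le> f i x" if "i < r" for i
    using f(1)[OF that] by (auto simp: continuous_map_in_subtopology)
  define g where "g x = (\<Sum>i<r. f i x)" for x
  have g_pos: "0 < g x" if x: "x \<in> topspace X" for x
  proof -
    obtain i where i: "i < r" "x \<in> W i"
      using W(3) x by auto
    then have "x \<in> X closure_of W i"
      using W(1) by (meson closure_of_subset lessThan_iff openin_subset subsetD)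
    then have "f i x = 1"
      using f(3)[OF i(1)] by blast
    then show ?thesis
      unfolding g_def using i(1) f_nonneg x by (intro sum_pos2[of _ i]) auto
  qed
  define s where "s x i = (\<Sum>k<i. f k x) / g x" for x i
  have diff: "s x (Suc i) = s x i + f i x / g x" for x i
    by (simp add: s_def add_divide_distrib)
  show thesis
  proof
    show "continuous_map X euclideanreal (\<lambda>x. s x i)" if "i \<le> r" for i
      unfolding s_def
    proof (intro continuous_map_real_divide continuous_map_sum)
      show "continuous_map X euclideanreal g"
        unfolding g_def using f_cont by (intro continuous_map_sum) auto
      show "g x \<noteq> 0" if "x \<in> topspace X" for x
        using g_pos[OF that] by simp
    qed (use that f_cont in auto)
    show "s x 0 = 0" for x by (simp add: s_def)
    show "s x r = 1" if "x \<in> topspace X" for x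
      using g_pos[OF that] by (simp add: s_def g_def)
    show "s x i \<le> s x (Suc i)" if "x \<in> topspace X" "i < r" for x i
      using that f_nonneg g_pos by (auto simp: diff less_imp_le)
    show "x \<in> V i" if "x \<in> topspace X" "i < r" "s x i < s x (Suc i)" for x i
    proof (rule ccontr)
      assume "x \<notin> V i"
      then have "f i x = 0" using f(2) that by blast
      then show False using that(3) by (simp add: diff)
    qed
  qed
qed

section \<open>Covers of compact cylinders\<close>

text \<open>This is a Lebesgue number in the \<open>t\<close> direction alone: one \<open>Q\<close>
  serves every \<open>t\<close>, while the member containing the box may vary with \<open>t\<close>.
  Compactness gives finitely many boxes, and intersecting all their base sets through a given point
  yields such a \<open>Q\<close>.\<close>

lemma compact_cylinder_cover_uniform:
  assumes "compact_space X"
    and U: "\<And>U. U \<in> \<U> \<Longrightarrow> openin (prod_topology X (top_of_set {0..1::real})) U"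
    "\<Union>\<U> = topspace X \<times> {0..1}"
  obtains \<O> \<epsilon> where "finite \<O>" "\<And>Q. Q \<in> \<O> \<Longrightarrow> openin X Q" "\<Union>\<O> = topspace X" "\<epsilon> > 0"
    "\<And>Q t. Q \<in> \<O> \<Longrightarrow> t \<in> {0..1} \<Longrightarrow> \<exists>U\<in>\<U>. Q \<times> ({t - \<epsilon><..<t + \<epsilon>} \<inter> {0..1}) \<subseteq> U"
proof -
  define P where "P = prod_topology X (top_of_set {0..1::real})"
  have P_top: "topspace P = topspace X \<times> {0..1}" by (simp add: P_def)
  \<comment> \<open>The box of half-width \<open>2 * e\<close> fits into a member; boxes of
    half-width \<open>e\<close> will form the cover, leaving room around each of their
    points.\<close>
  have "\<exists>Q e. openin X Q \<and> 0 < e \<and> fst p \<in> Q \<and> (\<exists>U\<in>\<U>. Q \<times> ({snd p - 2 * e<..<snd p + 2 * e} \<inter> {0..1}) \<subseteq> U)"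
    if p: "p \<in> topspace P" for p
  proof -
    obtain U where "U \<in> \<U>" "p \<in> U" using p U(2) P_top by blast
    then obtain Q R where QR: "openin X Q" "openin (top_of_set {0..1}) R" "fst p \<in> Q" "snd p \<in> R" "Q \<times> R \<subseteq> U"
      using U(1) unfolding openin_prod_topology_alt by (metis prod.collapse)
    obtain S where S: "open S" "R = {0..1} \<inter> S"
      using QR(2) by (auto simp: openin_open)
    then obtain d where d: "d > 0" "ball (snd p) d \<subseteq> S"
      using QR(4) open_contains_ball by blast
    have "{snd p - 2 * (d/2)<..<snd p + 2 * (d/2)} \<inter> {0..1} \<subseteq> R"
      using d S by (auto simp: ball_def dist_real_def subset_iff abs_less_iff)
    then have "Q \<times> ({snd p - 2 * (d/2)<..<snd p + 2 * (d/2)} \<inter> {0..1}) \<subseteq> U"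
      using QR(5) by blast
    then show ?thesis
      using QR d \<open>U \<in> \<U>\<close> by (intro exI[of _ Q] exI[of _ "d/2"]) auto
  qed
  then obtain Q e where Q: "\<And>p. p \<in> topspace P \<Longrightarrow> openin X (Q p)" "\<And>p. p \<in> topspace P \<Longrightarrow> 0 < e p"
    "\<And>p. p \<in> topspace P \<Longrightarrow> fst p \<in> Q p"
    "\<And>p. p \<in> topspace P \<Longrightarrow> \<exists>U\<in>\<U>. Q p \<times> ({snd p - 2 * e p<..<snd p + 2 * e p} \<inter> {0..1}) \<subseteq> U"
    by metis
  define B where "B p = Q p \<times> ({snd p - e p<..<snd p + e p} \<inter> {0..1})" for p
  have "compact_space P"
    unfolding P_def using assms(1) by (simp add: compact_space_prod_topology compact_space_subtopology)
  moreover have B: "openin P (B p)" if "p \<in> topspace P" for p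
    unfolding B_def P_def openin_prod_Times_iff
    using Q(1)[OF that] by (auto intro: openin_subtopology_Int)
  moreover have "\<Union>(B ` topspace P) = topspace P"
  proof
    show "\<Union>(B ` topspace P) \<subseteq> topspace P"
      using B openin_subset by blast
    have "p \<in> B p" if "p \<in> topspace P" for p
      using that Q(2,3)[OF that] P_top by (cases p) (auto simp: B_def)
    then show "topspace P \<subseteq> \<Union>(B ` topspace P)" by blast
  qed
  ultimately obtain \<F> where \<F>: "finite \<F>" "\<F> \<subseteq> B ` topspace P" "\<Union>\<F> = topspace P"
    unfolding compact_space by (metis (no_types, lifting) imageE)
  obtain F where F: "F \<subseteq> topspace P" "finite F" "\<F> = B ` F"
    using finite_subset_image[OF \<F>(1,2)] by blast
  \<comment> \<open>The inserted \<open>1\<close> keeps \<open>Min\<close> meaningful when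
    \<open>F\<close> is empty.\<close>
  define \<epsilon> where "\<epsilon> = Min (insert 1 (e ` F))"
  have \<epsilon>: "\<epsilon> > 0" "\<And>p. p \<in> F \<Longrightarrow> \<epsilon> \<le> e p"
    using F Q(2) by (auto simp: \<epsilon>_def subset_iff)
  \<comment> \<open>Intersecting with \<open>topspace X\<close> makes \<open>M {}\<close> the whole
    space. As \<open>N x\<close> depends only on a subset of \<open>F\<close>, finitely many sets
    arise.\<close>
  define M where "M S = \<Inter>(Q ` S) \<inter> topspace X" for S
  define N where "N x = M {p \<in> F. x \<in> Q p}" for x
  have M_open: "openin X (M S)" if "S \<subseteq> F" for S
  proof -
    have "finite S" using that F(2) finite_subset by blast
    then show ?thesis
      unfolding M_def using that F(1) Q(1) by (intro openin_INT) auto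
  qed
  show thesis
  proof
    have "N ` topspace X \<subseteq> M ` Pow F" by (auto simp: N_def)
    then show "finite (N ` topspace X)"
      using F(2) by (meson finite_Pow_iff finite_imageI finite_subset)
    show op: "openin X Q'" if "Q' \<in> N ` topspace X" for Q'
      using that M_open by (auto simp: N_def)
    show "\<Union>(N ` topspace X) = topspace X"
      by (auto simp: N_def M_def)
    show "\<epsilon> > 0" by fact
    fix Q' and t :: real assume "Q' \<in> N ` topspace X" and t: "t \<in> {0..1}"
    then obtain x where x: "x \<in> topspace X" "Q' = N x" by blast
    then obtain p where p: "p \<in> F" "(x, t) \<in> B p"
      using \<F>(3) F(3) t P_top by blast
    then obtain U where U': "U \<in> \<U>" "Q p \<times> ({snd p - 2 * e p<..<snd p + 2 * e p} \<inter> {0..1}) \<subseteq> U"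
      using Q(4) F(1) by blast
    have "N x \<subseteq> Q p" using p by (auto simp: N_def M_def B_def)
    \<comment> \<open>Here \<open>t\<close> is within \<open>e p\<close> of \<open>snd p\<close>,
      and \<open>\<epsilon> \<le> e p\<close>; together they use up the doubled width.\<close>
    moreover have "{t - \<epsilon><..<t + \<epsilon>} \<subseteq> {snd p - 2 * e p<..<snd p + 2 * e p}"
      using p \<epsilon>(2)[OF p(1)] by (auto simp: B_def)
    ultimately show "\<exists>U\<in>\<U>. Q' \<times> ({t - \<epsilon><..<t + \<epsilon>} \<inter> {0..1}) \<subseteq> U"
      using U' x(2) by blast
  qed
qed

text \<open>The index \<open>i\<close> of a tile confines \<open>x\<close> to \<open>V i\<close>,
  and the translate \<open>j\<close> confines \<open>t\<close> to a neighbourhood of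
  \<open>j / K\<close>; so the sets \<open>W (i, j)\<close> are as small as the cover demands, while
  the tile count bounds their order.\<close>

lemma covering_dim_le_cylinder:
  assumes X: "compact_space X" "Hausdorff_space X" and dim: "covering_dim_le X n"
  shows "covering_dim_le (prod_topology X (top_of_set {0..1::real})) (n + 1)"
proof (rule covering_dim_leI)
  show "-1 \<le> n + 1" using dim by (simp add: covering_dim_le_def)
  define P where "P = prod_topology X (top_of_set {0..1::real})"
  have P_top: "topspace P = topspace X \<times> {0..1}" by (simp add: P_def)
  fix \<U> assume "finite \<U>" and U: "\<And>U. U \<in> \<U> \<Longrightarrow> openin (prod_topology X (top_of_set {0..1::real})) U"
    "\<Union>\<U> = topspace (prod_topology X (top_of_set {0..1::real}))"
  have "\<Union>\<U> = topspace X \<times> {0..1}" using U(2) by simp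
  from compact_cylinder_cover_uniform[OF X(1) U(1) this]
  obtain \<O> \<epsilon> where \<O>: "finite \<O>" "\<And>Q. Q \<in> \<O> \<Longrightarrow> openin X Q" "\<Union>\<O> = topspace X" "\<epsilon> > 0"
    "\<And>Q t. Q \<in> \<O> \<Longrightarrow> t \<in> {0..1} \<Longrightarrow> \<exists>U\<in>\<U>. Q \<times> ({t - \<epsilon><..<t + \<epsilon>} \<inter> {0..1}) \<subseteq> U"
    by metis
  obtain r and Q :: "nat \<Rightarrow> _" where Q: "\<O> = Q ` {i. i < r}"
    using finite_imp_nat_seg_image_inj_on[OF \<O>(1)] by blast
  have Q1: "openin X (Q i)" if "i \<in> {..<r}" for i
    using \<O>(2) Q that by blast
  have Q2: "\<Union>(Q ` {..<r}) = topspace X"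
    using \<O>(3) Q by (simp add: lessThan_def)
  obtain V where V: "\<forall>i\<in>{..<r}. openin X (V i)" "\<forall>i\<in>{..<r}. V i \<subseteq> Q i"
      "\<Union>(V ` {..<r}) = topspace X" "\<forall>x\<in>topspace X. int (card {i\<in>{..<r}. x \<in> V i}) \<le> n + 1"
    by (rule covering_dim_le_indexed_refinement[OF dim finite_lessThan Q1 Q2]) (assumption | rule that)+
  have "normal_space X"
    using X compact_Hausdorff_or_regular_imp_normal_space by blast
  moreover have "\<And>i. i < r \<Longrightarrow> openin X (V i)" using V(1) by blast
  ultimately obtain s :: "_ \<Rightarrow> nat \<Rightarrow> real" where
    s: "\<And>i. i \<le> r \<Longrightarrow> continuous_map X euclideanreal (\<lambda>x. s x i)"
    "\<And>x. s x 0 = 0" "\<And>x. x \<in> topspace X \<Longrightarrow> s x r = 1"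
    "\<And>x i. x \<in> topspace X \<Longrightarrow> i < r \<Longrightarrow> s x i \<le> s x (Suc i)"
    "\<And>x i. x \<in> topspace X \<Longrightarrow> i < r \<Longrightarrow> s x i < s x (Suc i) \<Longrightarrow> x \<in> V i"
    using partition_of_unit_interval_subordinate[of X r V] V(3) by metis
  \<comment> \<open>Scaling by \<open>K\<close> makes a unit window correspond to a length below
    \<open>\<epsilon>\<close> in \<open>t\<close>.\<close>
  obtain K :: nat where K: "K > 0" "1 / real K < \<epsilon>"
    using \<O>(4) by (metis nat_approx_posE zero_less_Suc)
  \<comment> \<open>The value \<open>j = K\<close> serves \<open>t = 1\<close>, where the integer
    part of \<open>real K * t\<close> is \<open>K\<close>.\<close>
  define I where "I = {..<r} \<times> {..K}"
  define W where "W = (\<lambda>(i, j). {p \<in> topspace P. s (fst p) i < s (fst p) (Suc i) \<and>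
      s (fst p) i + real j < real K * snd p + 1 \<and> real K * snd p < s (fst p) (Suc i) + real j})"
  have fst_cont: "continuous_map P euclideanreal (\<lambda>p. s (fst p) i)" if "i \<le> r" for i
    using continuous_map_compose[OF continuous_map_fst s(1)[OF that]] by (simp add: P_def o_def)
  have snd_cont: "continuous_map P euclideanreal snd"
    unfolding P_def by (meson continuous_map_in_subtopology continuous_map_snd)
  have openin_less: "openin P {p \<in> topspace P. f p < g p}"
    if "continuous_map P euclideanreal f" "continuous_map P euclideanreal g" for f g :: "_ \<Rightarrow> real"
  proof -
    have "continuous_map P euclideanreal (\<lambda>p. g p - f p)"
      using that by (intro continuous_map_diff)
    then have "openin P {p \<in> topspace P. g p - f p \<in> {0<..}}"
      by (rule openin_continuous_map_preimage) auto
    then show ?thesis by simp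
  qed
  have W_open: "openin P (W ij)" if ij_I: "ij \<in> I" for ij
  proof -
    obtain i j where ij: "ij = (i, j)" "i < r" using ij_I by (cases ij) (auto simp: I_def)
    have "W ij = {p \<in> topspace P. s (fst p) i < s (fst p) (Suc i)} \<inter>
       {p \<in> topspace P. s (fst p) i + real j < real K * snd p + 1} \<inter>
       {p \<in> topspace P. real K * snd p < s (fst p) (Suc i) + real j}"
      by (auto simp: W_def ij)
    moreover have "openin P \<dots>"
      using ij(2) by (intro openin_Int openin_less continuous_map_add continuous_map_real_mult fst_cont snd_cont) auto
    ultimately show ?thesis by simp
  qed
  have sub: "\<exists>U\<in>\<U>. W ij \<subseteq> U" if ij_I: "ij \<in> I" for ij
  proof -
    obtain i j where ij: "ij = (i, j)" "i < r" "j \<le> K" using ij_I by (cases ij) (auto simp: I_def)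
    have "real j / real K \<in> {0..1}" using ij K by (simp add: field_simps)
    then obtain U' where U': "U' \<in> \<U>" "Q i \<times> ({real j / real K - \<epsilon><..<real j / real K + \<epsilon>} \<inter> {0..1}) \<subseteq> U'"
      using \<O>(5)[of "Q i"] Q ij(2) by blast
    have "W ij \<subseteq> Q i \<times> ({real j / real K - \<epsilon><..<real j / real K + \<epsilon>} \<inter> {0..1})"
    proof
      fix p assume p: "p \<in> W ij"
      obtain x t where xt: "p = (x, t)" by (cases p)
      have x: "x \<in> topspace X" "t \<in> {0..1}" using p by (auto simp: W_def ij xt P_top)
      have lt: "s x i < s x (Suc i)" "s x i + real j < real K * t + 1" "real K * t < s x (Suc i) + real j"
        using p by (auto simp: W_def ij xt)
      have s_mono: "s x a \<le> s x b" if "a \<le> b" "b \<le> r" for a b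
        using le_of_steps[of r "s x"] s(4)[OF x(1)] that by blast
      have "0 \<le> s x i" "s x (Suc i) \<le> 1"
        using s_mono[of 0 i] s_mono[of "Suc i" r] ij(2) s(2,3) x(1) by auto
      then have "real j - 1 < real K * t" "real K * t < real j + 1"
        using lt by auto
      then have "real j / real K - 1 / real K < t" "t < real j / real K + 1 / real K"
        using K(1) by (simp_all add: field_simps)
      then have "t \<in> {real j / real K - \<epsilon><..<real j / real K + \<epsilon>}"
        using K(2) by auto
      moreover have "x \<in> Q i" using s(5)[OF x(1) ij(2) lt(1)] V(2) ij(2) by auto
      ultimately show "p \<in> Q i \<times> ({real j / real K - \<epsilon><..<real j / real K + \<epsilon>} \<inter> {0..1})"
        using x(2) xt by auto
    qed
    then show ?thesis using U' by blast
  qed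
  have cover: "\<Union>(W ` I) = topspace P"
  proof
    show "\<Union>(W ` I) \<subseteq> topspace P" by (auto simp: W_def)
    show "topspace P \<subseteq> \<Union>(W ` I)"
    proof
      fix p assume p: "p \<in> topspace P"
      obtain x t where xt: "p = (x, t)" by (cases p)
      have x: "x \<in> topspace X" "0 \<le> t" "t \<le> 1" using p by (auto simp: xt P_top)
      define y where "y = real K * t"
      have y: "0 \<le> y" "y \<le> real K" using x K by (auto simp: y_def mult_left_le)
      obtain i where i: "i < r" "s x i + real (nat \<lfloor>y\<rfloor>) \<le> y" "y < s x (Suc i) + real (nat \<lfloor>y\<rfloor>)"
        using tile_containing_point[of "s x" r y] s(2,3) x(1) y(1) by metis
      have "nat \<lfloor>y\<rfloor> \<le> K" using y by linarith
      then have "(i, nat \<lfloor>y\<rfloor>) \<in> I" using i(1) by (simp add: I_def)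
      moreover have "p \<in> W (i, nat \<lfloor>y\<rfloor>)"
        using p i unfolding W_def xt y_def by auto
      ultimately show "p \<in> \<Union>(W ` I)" by blast
    qed
  qed
  have order: "int (card {ij\<in>I. p \<in> W ij}) \<le> n + 1 + 1" if p: "p \<in> topspace P" for p
  proof -
    obtain x t where xt: "p = (x, t)" by (cases p)
    have x: "x \<in> topspace X" using p by (auto simp: xt P_top)
    define T where "T = {(i, j::nat). i < r \<and> s x i < s x (Suc i) \<and> s x i + real j < real K * t + 1 \<and> real K * t < s x (Suc i) + real j}"
    have T: "finite T" "card T \<le> card {i. i < r \<and> s x i < s x (Suc i)} + 1"
      unfolding T_def using card_tiles_meeting_unit_window[of r "s x"] s(2,3,4) x by auto
    have "card {ij\<in>I. p \<in> W ij} \<le> card T"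
      using T(1) by (rule card_mono) (auto simp: T_def W_def I_def xt)
    \<comment> \<open>Nondegenerate intervals at \<open>x\<close> belong to indices with
      \<open>x \<in> V i\<close>, at most \<open>n + 1\<close> of them; the window adds one
      tile.\<close>
    moreover have "card {i. i < r \<and> s x i < s x (Suc i)} \<le> card {i\<in>{..<r}. x \<in> V i}"
      using s(5)[OF x] by (intro card_mono) auto
    ultimately show ?thesis using T(2) V(4) x by fastforce
  qed
  show "\<exists>(I::(nat \<times> nat) set) V. finite I \<and> (\<forall>i\<in>I. openin (prod_topology X (top_of_set {0..1})) (V i)) \<and>
      \<Union>(V ` I) = topspace (prod_topology X (top_of_set {0..1})) \<and> (\<forall>i\<in>I. \<exists>U\<in>\<U>. V i \<subseteq> U) \<and>
      (\<forall>x\<in>topspace (prod_topology X (top_of_set {0..1})). int (card {i\<in>I. x \<in> V i}) \<le> n + 1 + 1)"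
    unfolding P_def[symmetric]
    using W_open sub cover order by (intro exI[of _ I] exI[of _ W] conjI ballI) (auto simp: I_def)
qed

section \<open>The orbit space of the join\<close>

context continuous_right_action
begin

abbreviation join_orbit :: "'x \<times> 'g \<times> real \<Rightarrow> ('x \<times> 'g \<times> real) set set" where
  "join_orbit p \<equiv> orbit_rel G (join_topology X T) (join_act G act) `` {join_rel X T `` {p}}"

text \<open>Every orbit contains a class represented with group coordinate \<open>\<one>\<close>, so
  this restriction of \<open>join_orbit\<close> still reaches the whole orbit space.\<close>

abbreviation cylinder_orbit :: "'x \<times> real \<Rightarrow> ('x \<times> 'g \<times> real) set set" where
  "cylinder_orbit p \<equiv> join_orbit (fst p, \<one>, snd p)"

lemma join_orbit_eq:
  assumes "x \<in> topspace X" "h \<in> carrier G" "t \<in> {0..1}"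
  shows "join_orbit (x, h, t) = (\<lambda>g. join_rel X T `` {(act x g, h \<otimes> g, t)}) ` carrier G"
proof -
  have "join_rel X T `` {(x, h, t)} \<in> topspace (join_topology X T)"
    using assms unfolding join_topology_def topspace_quotient_topology
    by (intro quotientI) (simp add: topspace_eq_carrier)
  then have "join_orbit (x, h, t) = (\<lambda>g. join_act G act (join_rel X T `` {(x, h, t)}) g) ` carrier G"
    by (auto simp: orbit_rel_def)
  also have "\<dots> = (\<lambda>g. join_rel X T `` {(act x g, h \<otimes> g, t)}) ` carrier G"
    using assms join_act_class by (intro image_cong) auto
  finally show ?thesis .
qed

text \<open>Left translation by \<open>g\<close> permutes the carrier, so both orbits run through
  the same classes.\<close>

lemma join_orbit_act:
  assumes "x \<in> topspace X" "h \<in> carrier G" "t \<in> {0..1}" "g \<in> carrier G"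
  shows "join_orbit (act x g, h \<otimes> g, t) = join_orbit (x, h, t)"
proof -
  have "(\<lambda>k. join_rel X T `` {(act (act x g) k, h \<otimes> g \<otimes> k, t)}) ` carrier G
      = (\<lambda>k. join_rel X T `` {(act x k, h \<otimes> k, t)}) ` (\<lambda>k. g \<otimes> k) ` carrier G"
    unfolding image_image using assms by (intro image_cong) (auto simp: act_mult m_assoc)
  also have "(\<lambda>k. g \<otimes> k) ` carrier G = carrier G"
    using assms(4) by (metis surj_const_mult)
  finally show ?thesis
    using assms by (simp add: join_orbit_eq act_closed)
qed

lemma join_class_eq_iff:
  assumes "x \<in> topspace X" "h \<in> carrier G" "t \<in> {0..1}" "x' \<in> topspace X" "h' \<in> carrier G" "t' \<in> {0..1}"
  shows "join_rel X T `` {(x, h, t)} = join_rel X T `` {(x', h', t')} \<longleftrightarrow>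
    t = t' \<and> (x = x' \<and> h = h' \<or> t = 0 \<and> h = h' \<or> t = 1 \<and> x = x')"
proof -
  have "join_rel X T `` {(x, h, t)} = join_rel X T `` {(x', h', t')} \<longleftrightarrow> ((x, h, t), (x', h', t')) \<in> join_rel X T"
    using assms by (intro eq_equiv_class_iff[OF equiv_join_rel]) (auto simp: topspace_eq_carrier)
  also have "\<dots> \<longleftrightarrow> t = t' \<and> (x = x' \<and> h = h' \<or> t = 0 \<and> h = h' \<or> t = 1 \<and> x = x')"
    using assms by (auto simp: join_rel_def topspace_eq_carrier)
  finally show ?thesis .
qed

text \<open>Two points share an orbit when some \<open>g\<close> carries one class to the other. For
  \<open>t < 1\<close> the group coordinate survives and forces \<open>g = \<one>\<close>, and at
  \<open>t = 0\<close> the \<open>X\<close> coordinate is forgotten; at \<open>t = 1\<close> only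
  the \<open>X\<close> coordinate remains and \<open>g\<close> is arbitrary.\<close>

lemma cylinder_orbit_eq_iff:
  assumes "x \<in> topspace X" "t \<in> {0..1}" "x' \<in> topspace X" "t' \<in> {0..1}"
  shows "cylinder_orbit (x, t) = cylinder_orbit (x', t') \<longleftrightarrow>
    t = t' \<and> (x = x' \<or> t = 0 \<or> t = 1 \<and> (\<exists>g\<in>carrier G. x' = act x g))"
proof
  assume eq: "cylinder_orbit (x, t) = cylinder_orbit (x', t')"
  have "join_rel X T `` {(act x' \<one>, \<one> \<otimes> \<one>, t')} \<in> join_orbit (x', \<one>, t')"
    using assms by (subst join_orbit_eq) auto
  then have "join_rel X T `` {(x', \<one>, t')} \<in> join_orbit (x, \<one>, t)"
    using assms eq by (simp add: act_one)
  then obtain g where g: "g \<in> carrier G" "join_rel X T `` {(x', \<one>, t')} = join_rel X T `` {(act x g, \<one> \<otimes> g, t)}"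
    using assms by (subst (asm) join_orbit_eq) auto
  then have "t' = t \<and> (x' = act x g \<and> \<one> = \<one> \<otimes> g \<or> t' = 0 \<and> \<one> = \<one> \<otimes> g \<or> t' = 1 \<and> x' = act x g)"
    using assms by (subst (asm) join_class_eq_iff) (auto simp: act_closed)
  then show "t = t' \<and> (x = x' \<or> t = 0 \<or> t = 1 \<and> (\<exists>g\<in>carrier G. x' = act x g))"
    using g(1) assms act_one by auto
next
  assume R: "t = t' \<and> (x = x' \<or> t = 0 \<or> t = 1 \<and> (\<exists>g\<in>carrier G. x' = act x g))"
  show "cylinder_orbit (x, t) = cylinder_orbit (x', t')"
  proof (cases "t = 1 \<and> (\<exists>g\<in>carrier G. x' = act x g)")
    case True
    then obtain g where g: "t = 1" "g \<in> carrier G" "x' = act x g" by blast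
    \<comment> \<open>At \<open>t = 1\<close> the group coordinate may be replaced by
      \<open>g\<close>, after which the point is a translate of
      \<open>(x, \<one>, 1)\<close>.\<close>
    have "join_rel X T `` {(act x g, \<one>, 1)} = join_rel X T `` {(act x g, \<one> \<otimes> g, 1)}"
      using assms g by (subst join_class_eq_iff) (auto simp: act_closed)
    then show ?thesis
      using join_orbit_act[of x \<one> 1 g] assms R g by simp
  next
    case False
    then have "join_rel X T `` {(x, \<one>, t)} = join_rel X T `` {(x', \<one>, t')}"
      using assms R by (subst join_class_eq_iff) auto
    then show ?thesis by simp
  qed
qed

text \<open>The quotient map \<open>join_orbit\<close> factors as the continuous map sending
  \<open>(x, h, t)\<close> to \<open>(act x (inv h), t)\<close> followed by
  \<open>cylinder_orbit\<close>. The last factor of a quotient map is a quotient map when both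
  factors are continuous.\<close>

lemma quotient_map_cylinder_orbit:
  "quotient_map (prod_topology X (top_of_set {0..1})) (orbit_space G (join_topology X T) (join_act G act)) cylinder_orbit"
proof -
  define C where "C = prod_topology X (prod_topology T (top_of_set {0..1::real}))"
  define Z where "Z = orbit_space G (join_topology X T) (join_act G act)"
  have "quotient_map C (join_topology X T) (\<lambda>p. join_rel X T `` {p})"
    unfolding C_def join_topology_def by (rule quotient_map_quotient_topology)
  moreover have "quotient_map (join_topology X T) Z (\<lambda>c. orbit_rel G (join_topology X T) (join_act G act) `` {c})"
    unfolding Z_def orbit_space_def by (rule quotient_map_quotient_topology)
  ultimately have q: "quotient_map C Z join_orbit"
    using quotient_map_compose by (fastforce simp: o_def)
  have "continuous_map (prod_topology X (top_of_set {0..1})) C (\<lambda>p. (fst p, \<one>, snd p))"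
    unfolding C_def by (intro continuous_map_pairedI continuous_map_fst continuous_map_snd)
      (simp add: topspace_eq_carrier)
  from continuous_map_compose[OF this quotient_imp_continuous_map[OF q]]
  have cont: "continuous_map (prod_topology X (top_of_set {0..1})) Z cylinder_orbit"
    by (simp add: o_def)
  have "continuous_map C T (fst \<circ> snd)"
    unfolding C_def by (rule continuous_map_compose[OF continuous_map_snd continuous_map_fst])
  from continuous_map_compose[OF this continuous_inv]
  have "continuous_map C T (\<lambda>p. inv (fst (snd p)))"
    by (simp add: o_def)
  moreover have "continuous_map C X fst"
    unfolding C_def by (rule continuous_map_fst)
  ultimately have "continuous_map C (prod_topology X T) (\<lambda>p. (fst p, inv (fst (snd p))))"
    by (intro continuous_map_pairedI)
  from continuous_map_compose[OF this continuous_act]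
  have "continuous_map C X (\<lambda>p. act (fst p) (inv (fst (snd p))))"
    by (simp add: o_def)
  moreover have "continuous_map C (top_of_set {0..1}) (snd \<circ> snd)"
    unfolding C_def by (rule continuous_map_compose[OF continuous_map_snd continuous_map_snd])
  then have "continuous_map C (top_of_set {0..1}) (\<lambda>p. snd (snd p))"
    by (simp add: o_def)
  ultimately have r: "continuous_map C (prod_topology X (top_of_set {0..1}))
      (\<lambda>p. (act (fst p) (inv (fst (snd p))), snd (snd p)))"
    by (rule continuous_map_pairedI)
  have "quotient_map C Z (cylinder_orbit \<circ> (\<lambda>p. (act (fst p) (inv (fst (snd p))), snd (snd p))))"
  proof (rule quotient_map_eq[OF q])
    fix p assume "p \<in> topspace C"
    then obtain x h t where p: "p = (x, h, t)" "x \<in> topspace X" "h \<in> carrier G" "t \<in> {0..1}"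
      by (auto simp: C_def topspace_eq_carrier)
    then show "join_orbit p = (cylinder_orbit \<circ> (\<lambda>p. (act (fst p) (inv (fst (snd p))), snd (snd p)))) p"
      using join_orbit_act[of x h t "inv h"] by simp
  qed
  then show ?thesis
    using quotient_map_from_composition[OF r cont] by (simp add: Z_def)
qed

section \<open>Topology and dimension of the quotient\<close>

text \<open>For a quotient map it suffices that the saturation of a closed \<open>K\<close> is
  closed. Saturating adds only \<open>S0\<close>, the whole bottom if \<open>K\<close> meets it, and
  \<open>S1\<close>, the \<open>G\<close>-translates of the top part of \<open>K\<close>.\<close>

lemma closed_map_cylinder_orbit:
  assumes "compact_space X" "Hausdorff_space X" "compact_space T"
  shows "closed_map (prod_topology X (top_of_set {0..1})) (orbit_space G (join_topology X T) (join_act G act)) cylinder_orbit"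
  unfolding closed_map_def
proof (intro allI impI)
  define P where "P = prod_topology X (top_of_set {0..1::real})"
  define Z where "Z = orbit_space G (join_topology X T) (join_act G act)"
  have P_top: "topspace P = topspace X \<times> {0..1}" by (simp add: P_def)
  have P: "compact_space P" "Hausdorff_space P"
    using assms by (simp_all add: P_def compact_space_prod_topology compact_space_subtopology
        Hausdorff_space_prod_topology Hausdorff_space_subtopology)
  fix K :: "('x \<times> real) set" assume "closedin (prod_topology X (top_of_set {0..1})) K"
  then have K: "closedin P K" by (simp add: P_def)
  have K_sub: "K \<subseteq> topspace X \<times> {0..1}" using closedin_subset[OF K] P_top by simp
  have snd_closed: "closedin P (topspace X \<times> {c})" if "c \<in> {0..1}" for c :: real
    unfolding P_def using that by (simp add: closedin_prod_Times_iff closedin_closed_subset)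
  define S0 where "S0 = (if K \<inter> topspace X \<times> {0} = {} then {} else topspace X \<times> {0::real})"
  define S1 where "S1 = (\<lambda>q. (act (fst (fst q)) (snd q), snd (fst q))) ` ((K \<inter> topspace X \<times> {1}) \<times> carrier G)"
  have "closedin P S0"
    unfolding S0_def using snd_closed[of 0] by simp
  \<comment> \<open>Compactness of the group makes \<open>S1\<close> a continuous image of a compact
    set, hence closed in the Hausdorff cylinder.\<close>
  have "compactin P (K \<inter> topspace X \<times> {1})"
    using K snd_closed[of 1] P(1) by (intro closedin_compact_space closedin_Int) auto
  moreover have "compactin T (carrier G)"
    using assms(3) by (simp add: compact_space_def topspace_eq_carrier)
  ultimately have "compactin (prod_topology P T) ((K \<inter> topspace X \<times> {1}) \<times> carrier G)"
    by (simp add: compactin_Times)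
  moreover have "continuous_map (prod_topology P T) P (\<lambda>q. (act (fst (fst q)) (snd q), snd (fst q)))"
  proof -
    have "continuous_map (prod_topology P T) X (\<lambda>q. fst (fst q))"
      using continuous_map_compose[OF continuous_map_fst continuous_map_fst]
      unfolding P_def by (simp add: o_def)
    then have "continuous_map (prod_topology P T) X (\<lambda>q. act (fst (fst q)) (snd q))"
      using continuous_map_compose[OF continuous_map_pairedI continuous_act, of "prod_topology P T" _ snd]
      by (simp add: o_def continuous_map_snd)
    moreover have "continuous_map (prod_topology P T) (top_of_set {0..1}) (\<lambda>q. snd (fst q))"
      using continuous_map_compose[OF continuous_map_fst continuous_map_snd]
      unfolding P_def by (simp add: o_def)
    ultimately show ?thesis
      by (subst (2) P_def) (rule continuous_map_pairedI)
  qed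
  ultimately have "compactin P S1"
    unfolding S1_def by (rule image_compactin)
  then have "closedin P S1"
    using P(2) by (simp add: compactin_imp_closedin)
  have "{p \<in> topspace P. cylinder_orbit p \<in> cylinder_orbit ` K} = K \<union> S0 \<union> S1" (is "?L = ?R")
  proof
    show "?L \<subseteq> ?R"
    proof
      fix p assume "p \<in> ?L"
      then obtain x t x' t' where *: "p = (x, t)" "x \<in> topspace X" "t \<in> {0..1}" "(x', t') \<in> K"
        "cylinder_orbit (x', t') = cylinder_orbit (x, t)"
        by (auto simp: P_top)
      moreover have "x' \<in> topspace X" "t' \<in> {0..1}" using * K_sub by auto
      ultimately have "t' = t \<and> (x' = x \<or> t' = 0 \<or> t' = 1 \<and> (\<exists>g\<in>carrier G. x = act x' g))"
        by (subst (asm) cylinder_orbit_eq_iff) auto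
      then consider "p \<in> K" | "t' = 0" "t = 0" | g where "t' = 1" "t = 1" "g \<in> carrier G" "x = act x' g"
        using * by auto
      then show "p \<in> ?R"
      proof cases
        case 2
        then show ?thesis using * \<open>x' \<in> topspace X\<close> by (auto simp: S0_def)
      next
        case 3
        then have "p = (act (fst (fst ((x', t'), g))) (snd ((x', t'), g)), snd (fst ((x', t'), g)))"
          using * by simp
        moreover have "((x', t'), g) \<in> (K \<inter> topspace X \<times> {1}) \<times> carrier G"
          using 3 * \<open>x' \<in> topspace X\<close> by auto
        ultimately show ?thesis unfolding S1_def by blast
      qed auto
    qed
    show "?R \<subseteq> ?L"
    proof
      fix p assume "p \<in> ?R"
      then consider "p \<in> K" | "p \<in> S0" | "p \<in> S1" by blast
      then show "p \<in> ?L"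
      proof cases
        case 1
        then show ?thesis using K_sub P_top by auto
      next
        case 2
        then obtain x x' where x: "p = (x, 0)" "x \<in> topspace X" "(x', 0) \<in> K" "x' \<in> topspace X"
          by (auto simp: S0_def split: if_splits)
        then have "cylinder_orbit p = cylinder_orbit (x', 0)"
          using cylinder_orbit_eq_iff[of x 0 x' 0] by simp
        then show ?thesis
          using x P_top by (auto intro!: image_eqI[of _ _ "(x', 0)"])
      next
        case 3
        then obtain x g where x: "p = (act x g, 1)" "x \<in> topspace X" "(x, 1) \<in> K" "g \<in> carrier G"
          by (auto simp: S1_def)
        then have "cylinder_orbit p = cylinder_orbit (x, 1)"
          using cylinder_orbit_eq_iff[of x 1 "act x g" 1] act_closed by auto
        then show ?thesis
          using x P_top act_closed by (auto intro!: image_eqI[of _ _ "(x, 1)"])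
      qed
    qed
  qed
  moreover have "closedin P (K \<union> S0 \<union> S1)"
    using K \<open>closedin P S0\<close> \<open>closedin P S1\<close> by blast
  moreover have "cylinder_orbit ` K \<subseteq> topspace Z"
    using image_mono[OF closedin_subset[OF K], of cylinder_orbit]
      quotient_imp_surjective_map[OF quotient_map_cylinder_orbit] unfolding P_def Z_def by simp
  ultimately have "closedin Z (cylinder_orbit ` K)"
    using quotient_map_cylinder_orbit[folded P_def Z_def, unfolded quotient_map_closedin, THEN conjunct2,
        THEN spec, of "cylinder_orbit ` K"] by simp
  then show "closedin (orbit_space G (join_topology X T) (join_act G act)) (cylinder_orbit ` K)"
    by (simp add: Z_def)
qed

text \<open>This applies \<open>covering_dim_le_closed_image\<close> to the cylinder and the orbit
  space of \<open>X\<close>, both bounded in dimension by the maximum.\<close>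

lemma covering_dim_le_join_orbit_space:
  assumes X: "compact_space X" "Hausdorff_space X" and "compact_space T"
    and dim: "covering_dim_le (orbit_space G X act) m" "covering_dim_le X n"
  shows "covering_dim_le (orbit_space G (join_topology X T) (join_act G act)) (max m (n + 1))"
proof -
  define P where "P = prod_topology X (top_of_set {0..1::real})"
  define Z where "Z = orbit_space G (join_topology X T) (join_act G act)"
  have P_top: "topspace P = topspace X \<times> {0..1}" by (simp add: P_def)
  have P: "compact_space P" "Hausdorff_space P"
    using X by (simp_all add: P_def compact_space_prod_topology compact_space_subtopology
        Hausdorff_space_prod_topology Hausdorff_space_subtopology)
  have P_dim: "covering_dim_le P (max m (n + 1))"
    using covering_dim_le_cylinder[OF X dim(2)] covering_dim_le_mono unfolding P_def by fastforce
  have quot: "quotient_map P Z cylinder_orbit"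
    unfolding P_def Z_def by (rule quotient_map_cylinder_orbit)
  then have cont: "continuous_map P Z cylinder_orbit" and surj: "cylinder_orbit ` topspace P = topspace Z"
    by (auto simp: quotient_imp_continuous_map quotient_imp_surjective_map)
  have cl: "closed_map P Z cylinder_orbit"
    unfolding P_def Z_def using assms by (intro closed_map_cylinder_orbit)
  \<comment> \<open>Both properties pass along closed continuous surjections. The Hausdorff property
    is what later makes \<open>e\<close> a closed map out of a compact space.\<close>
  have Z: "normal_space Z" "Hausdorff_space Z"
    using normal_Hausdorff_space_closed_continuous_map_image[OF _ P(2) cl cont surj] P
      compact_Hausdorff_or_regular_imp_normal_space by blast+
  define f where "f = (\<lambda>x. orbit_rel G X act `` {x})"
  have f: "quotient_map X (orbit_space G X act) f"
    unfolding f_def orbit_space_def by (rule quotient_map_quotient_topology)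
  have f_eq: "f x = f y \<longleftrightarrow> (\<exists>g\<in>carrier G. y = act x g)" if "x \<in> topspace X" "y \<in> topspace X" for x y
    unfolding f_def eq_equiv_class_iff[OF equiv_orbit_rel that] using that by (auto simp: orbit_rel_def)
  have "continuous_map X P (\<lambda>x. (x, 1))"
    unfolding P_def by (intro continuous_map_pairedI) auto
  from continuous_map_compose[OF this cont]
  have h: "continuous_map X Z (\<lambda>x. cylinder_orbit (x, 1))"
    by (simp add: o_def)
  have h_eq: "cylinder_orbit (x, 1) = cylinder_orbit (y, 1) \<longleftrightarrow> f x = f y" if "x \<in> topspace X" "y \<in> topspace X" for x y
    using that f_eq[OF that] cylinder_orbit_eq_iff[of x 1 y 1] by auto
  \<comment> \<open>The top map from \<open>X\<close> and the orbit map \<open>f\<close> identify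
    the same points, so the former descends to the orbit space of \<open>X\<close> and is injective
    there.\<close>
  obtain e where e: "continuous_map (orbit_space G X act) Z e"
      "\<And>x. x \<in> topspace X \<Longrightarrow> e (f x) = cylinder_orbit (x, 1)"
    by (rule quotient_map_lift_exists[OF f h]) (use h_eq in auto)
  have f_surj: "f ` topspace X = topspace (orbit_space G X act)"
    using f by (rule quotient_imp_surjective_map)
  have e_inj: "inj_on e (topspace (orbit_space G X act))"
    unfolding f_surj[symmetric] inj_on_def using e(2) h_eq by auto
  have "compact_space (orbit_space G X act)"
    using image_compactin[of X "topspace X", OF _ quotient_imp_continuous_map[OF f]] X(1) f_surj
    by (simp add: compact_space_def)
  then have e_cl: "closed_map (orbit_space G X act) Z e"
    using e(1) Z(2) by (intro continuous_imp_closed_map)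
  \<comment> \<open>A single representative of the cone point; \<open>F\<close> is empty if \<open>X\<close> is.\<close>
  define F where "F = {(SOME x. x \<in> topspace X, 0::real)} \<inter> topspace P"
  have "closedin P F"
    using P(2) unfolding F_def by (intro closedin_Hausdorff_finite) auto
  have "inj_on cylinder_orbit F"
    by (auto simp: F_def inj_on_def)
  have "inj_on cylinder_orbit {p \<in> topspace P. cylinder_orbit p \<notin> cylinder_orbit ` F \<union> e ` topspace (orbit_space G X act)}"
  proof (rule inj_onI)
    \<comment> \<open>Off the cone point and the image of \<open>e\<close> only levels strictly
      between 0 and 1 remain, where \<open>cylinder_orbit\<close> identifies nothing.\<close>
    have interior: "t \<noteq> 0 \<and> t \<noteq> 1"
      if p: "p = (x, t)" "x \<in> topspace X" "t \<in> {0..1}"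
        "cylinder_orbit p \<notin> cylinder_orbit ` F \<union> e ` topspace (orbit_space G X act)" for p x t
    proof (intro conjI notI)
      assume "t = 0"
      define x0 where "x0 = (SOME x. x \<in> topspace X)"
      have x0: "x0 \<in> topspace X" unfolding x0_def using p(2) by (rule someI)
      then have "cylinder_orbit p = cylinder_orbit (x0, 0)"
        using p \<open>t = 0\<close> cylinder_orbit_eq_iff[of x 0 x0 0] by auto
      moreover have "(x0, 0) \<in> F" using x0 by (simp add: F_def P_top x0_def)
      ultimately show False using p(4) by blast
    next
      assume "t = 1"
      then have "cylinder_orbit p = e (f x)" using p e(2) by simp
      then show False using p(2,4) f_surj by blast
    qed
    fix p q
    assume p: "p \<in> {p \<in> topspace P. cylinder_orbit p \<notin> cylinder_orbit ` F \<union> e ` topspace (orbit_space G X act)}"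
      and q: "q \<in> {p \<in> topspace P. cylinder_orbit p \<notin> cylinder_orbit ` F \<union> e ` topspace (orbit_space G X act)}"
      and eq: "cylinder_orbit p = cylinder_orbit q"
    obtain x t y u where xt: "p = (x, t)" "q = (y, u)" "x \<in> topspace X" "t \<in> {0..1}" "y \<in> topspace X" "u \<in> {0..1}"
      using p q P_top by (cases p, cases q) auto
    have "t \<noteq> 0 \<and> t \<noteq> 1"
      using interior[OF xt(1,3,4)] p by blast
    then show "p = q"
      using cylinder_orbit_eq_iff[OF xt(3-6)] eq xt(1,2) by auto
  qed
  with Z(1) P_dim cont cl surj \<open>closedin P F\<close> \<open>inj_on cylinder_orbit F\<close>
    covering_dim_le_mono[OF dim(1) max.cobounded1] e(1) e_cl e_inj
  have "covering_dim_le Z (max m (n + 1))"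
    by (rule covering_dim_le_closed_image)
  then show ?thesis by (simp add: Z_def)
qed

end

section \<open>From bounds to dimensions as extended reals\<close>

theorem lemma2p17:
  fixes X :: "'x topology" and G :: "('g, 'm) monoid_scheme" and T :: "'g topology"
    and act :: "'x \<Rightarrow> 'g \<Rightarrow> 'x"
  assumes "compact_space X" and "metrizable_space X"
    and "topological_group G T" and "compact_space T"
    and "continuous_right_action G T X act"
    and "free_action G X act"
  shows "covering_dim (orbit_space G (join_topology X T) (join_act G act))
           \<le> max (covering_dim (orbit_space G X act)) (covering_dim X + 1)"
proof (cases "covering_dim (orbit_space G X act) = \<infinity> \<or> covering_dim X = \<infinity>")
  \<comment> \<open>The right-hand side is then \<infinity>.\<close>
  case True
  then show ?thesis by auto
next
  case False
  \<comment> \<open>With finite values both infima are attained, so the inequality reduces to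
    integer bounds.\<close>
  then obtain m n where m: "covering_dim_le (orbit_space G X act) m"
      "covering_dim (orbit_space G X act) = ereal (real_of_int m)"
    and n: "covering_dim_le X n" "covering_dim X = ereal (real_of_int n)"
    by (metis covering_dim_attained)
  interpret continuous_right_action G T X act by fact
  have "covering_dim_le (orbit_space G (join_topology X T) (join_act G act)) (max m (n + 1))"
    using assms metrizable_imp_Hausdorff_space m(1) n(1) by (intro covering_dim_le_join_orbit_space)
  then have "covering_dim (orbit_space G (join_topology X T) (join_act G act)) \<le> ereal (real_of_int (max m (n + 1)))"
    by (rule covering_dim_le_imp_le)
  also have "\<dots> = max (covering_dim (orbit_space G X act)) (covering_dim X + 1)"
    using m(2) n(2) by (simp add: max_def one_ereal_def)
  finally show ?thesis .
qed

end
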